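(* For any real $\gamma$ in $(0,1]$ and all sufficiently large real numbers $X$ and $Y$, there exists a subset $C$ of the integer points in $[1,X]\times[1,Y]$ satisfying $$|C|\;\geq\;\frac{\gamma}{8}\,XY \qquad\text{and}\qquad |\mathrm{Frac}(C)|\;\leq\;\frac{\gamma^2}{2}\,XY .$$
   Context: For a set $C$ of integer points $(a,b)$ with $a,b\geq 1$, $\mathrm{Frac}(C)$ denotes the set of rational numbers $a/b$ with $(a,b)\in C$, and $|\mathrm{Frac}(C)|$ is the number of distinct such rational numbers. $|\cdot|$ denotes cardinality. "For all sufficiently large $X$ and $Y$" means that there is a bound $N_0$, which may depend on $\gamma$, such that the assertion holds for all $X\geq N_0$ and $Y\geq N_0$. *)

theory Defs
  imports Complex_Main
begin

definition Frac :: "(int \<times> int) set \<Rightarrow> rat set" where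
  "Frac C = {of_int a / of_int b | a b. (a, b) \<in> C}"

definition int_points :: "real \<Rightarrow> real \<Rightarrow> (int \<times> int) set" where
  "int_points X Y = {(a, b). 1 \<le> a \<and> of_int a \<le> X \<and> 1 \<le> b \<and> of_int b \<le> Y}"

end

theory Submission
  imports Defs
begin

text \<open>
  A fraction \<open>p / q\<close> in lowest terms is represented once for every \<open>d\<close> such that
  \<open>(d p, d q)\<close> lies in the box, so the set \<open>C\<close> should consist of points whose
  greatest common divisor is large.  Fix \<open>D\<close> about \<open>2 / \<gamma>\<close> and let \<open>C\<close> be the set of
  points whose greatest common divisor lies in \<open>[D, 12 D)\<close>.

  Every fraction from \<open>C\<close> has a representative in \<open>[1, X/D] \<times> [1, Y/D]\<close>, so there are at
  most \<open>X Y / D\<^sup>2 \<le> \<gamma>\<^sup>2 X Y / 4\<close> of them.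

  The points with greatest common divisor exactly \<open>d\<close> correspond to the coprime pairs in
  \<open>[1, X/d] \<times> [1, Y/d]\<close>.  At least half of the pairs in any such box are coprime
  (\<open>coprime_pairs_ge_half\<close>), so these points number roughly \<open>X Y / (2 d\<^sup>2)\<close> at least.
  Summing over \<open>d\<close> with \<open>1 / d\<^sup>2 \<ge> 1 / d - 1 / (d + 1)\<close> gives about
  \<open>X Y / (2 D) \<cdot> 11/12\<close>, and \<open>1 / D \<ge> \<gamma> / 3\<close>.  Because \<open>d\<close> stays bounded, rounding \<open>X / d\<close>
  and \<open>Y / d\<close> down loses only a small proportion once \<open>X\<close> and \<open>Y\<close> are large, and the product
  of these constants stays above \<open>1 / 8\<close>.
\<close>

section \<open>Density of coprime pairs in a box\<close>

definition coprime_pairs :: "int \<Rightarrow> int \<Rightarrow> (int \<times> int) set" where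
  "coprime_pairs M N = {(a, b). a \<in> {1..M} \<and> b \<in> {1..N} \<and> coprime a b}"

definition common_multiples :: "int \<Rightarrow> int \<Rightarrow> int \<Rightarrow> (int \<times> int) set" where
  "common_multiples d M N = {(a, b). a \<in> {1..M} \<and> b \<in> {1..N} \<and> d dvd a \<and> d dvd b}"

text \<open>The points of greatest common divisor \<open>d\<close> are the images of coprime pairs under \<open>scale d\<close>.\<close>

definition scale :: "int \<Rightarrow> int \<times> int \<Rightarrow> int \<times> int" where
  "scale d = (\<lambda>(p, q). (d * p, d * q))"

lemma finite_coprime_pairs: "finite (coprime_pairs M N)"
  by (rule finite_subset[of _ "{1..M} \<times> {1..N}"]) (auto simp: coprime_pairs_def)

lemma card_common_multiples_le:
  assumes d: "0 < d" and "0 \<le> M" "0 \<le> N"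
  shows "real (card (common_multiples d M N)) \<le> of_int M * of_int N / (of_int d)\<^sup>2"
proof -
  have "common_multiples d M N \<subseteq> scale d ` ({1..M div d} \<times> {1..N div d})"
  proof
    fix z assume "z \<in> common_multiples d M N"
    then obtain p q where z: "z = (d * p, d * q)"
      and *: "1 \<le> d * p" "d * p \<le> M" "1 \<le> d * q" "d * q \<le> N"
      by (auto simp: common_multiples_def dvd_def)
    have "0 < p" "0 < q"
      using * d by (metis int_one_le_iff_zero_less zero_less_mult_pos)+
    moreover have "p \<le> M div d" "q \<le> N div d"
      using zdiv_mono1[OF *(2) d] zdiv_mono1[OF *(4) d] d by simp_all
    ultimately show "z \<in> scale d ` ({1..M div d} \<times> {1..N div d})"
      by (auto simp: z scale_def intro!: image_eqI[of _ _ "(p, q)"])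
  qed
  then have "card (common_multiples d M N) \<le> card ({1..M div d} \<times> {1..N div d})"
    by (intro surj_card_le) simp_all
  also have "\<dots> = nat (M div d) * nat (N div d)"
    by (simp add: card_cartesian_product)
  finally have "real (card (common_multiples d M N)) \<le> real (nat (M div d) * nat (N div d))"
    by linarith
  also have "\<dots> = of_int (M div d) * of_int (N div d)"
    using assms by (simp add: pos_imp_zdiv_nonneg_iff)
  also have "\<dots> \<le> (of_int M / of_int d) * (of_int N / of_int d)"
    using assms by (intro mult_mono real_of_int_div4)
      (auto simp: pos_imp_zdiv_nonneg_iff)
  finally show ?thesis by (simp add: power2_eq_square)
qed

text \<open>
  Apart from coprimality there are two cases: the greatest common divisor is even, so that 2
  is a common divisor, or it is itself an odd number \<open>2 k + 1 \<ge> 3\<close>.  Hence the proportion of pairs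
  that are not coprime is at most \<open>1/4 + \<Sum>k\<ge>1. 1 / (2 k + 1)\<^sup>2\<close>, and comparing
  \<open>(2 k + 1)\<^sup>2\<close> with \<open>4 k (k + 1)\<close> bounds the sum by a telescoping one with value 1/4.
\<close>

lemma coprime_pairs_ge_half:
  assumes "0 \<le> M" "0 \<le> N"
  shows "of_int M * of_int N / 2 \<le> real (card (coprime_pairs M N))"
proof -
  define n where "n = nat M"
  define odds where "odds = (\<Union>k\<in>{1..<Suc n}. common_multiples (2 * int k + 1) M N)"
  have cover: "{1..M} \<times> {1..N} \<subseteq> coprime_pairs M N \<union> (common_multiples 2 M N \<union> odds)"
  proof
    fix z assume "z \<in> {1..M} \<times> {1..N}"
    then obtain a b where z: "z = (a, b)" and ab: "a \<in> {1..M}" "b \<in> {1..N}" by auto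
    show "z \<in> coprime_pairs M N \<union> (common_multiples 2 M N \<union> odds)"
    proof (cases "coprime a b")
      case True
      then show ?thesis using ab z by (auto simp: coprime_pairs_def)
    next
      case not_coprime: False
      show ?thesis
      proof (cases "even (gcd a b)")
        case True
        then show ?thesis using ab z by (auto simp: common_multiples_def)
      next
        case False
        then obtain j where j: "gcd a b = 2 * j + 1" by (elim oddE)
        have "gcd a b \<noteq> 1" using not_coprime by (simp add: coprime_iff_gcd_eq_1)
        moreover have "0 < gcd a b" using ab by simp
        moreover have "gcd a b \<le> M" using ab by (intro order_trans[OF gcd_le1_int]) auto
        ultimately have "nat j \<in> {1..<Suc n}" "2 * int (nat j) + 1 = gcd a b"
          using j by (auto simp: n_def)
        moreover have "(a, b) \<in> common_multiples (gcd a b) M N"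
          using ab by (simp add: common_multiples_def)
        ultimately show ?thesis unfolding odds_def z by (metis UN_I UnI2)
      qed
    qed
  qed
  have fin: "finite (common_multiples d M N)" for d
    by (rule finite_subset[of _ "{1..M} \<times> {1..N}"]) (auto simp: common_multiples_def)
  have "nat M * nat N = card ({1..M} \<times> {1..N})"
    by (simp add: card_cartesian_product)
  also have "\<dots> \<le> card (coprime_pairs M N \<union> (common_multiples 2 M N \<union> odds))"
    using fin by (intro card_mono cover) (auto simp: odds_def finite_coprime_pairs)
  also have "\<dots> \<le> card (coprime_pairs M N) + (card (common_multiples 2 M N) + card odds)"
    by (meson card_Un_le add_left_mono order_trans)
  finally have "real (nat M * nat N)
      \<le> real (card (coprime_pairs M N) + (card (common_multiples 2 M N) + card odds))"
    by (rule of_nat_mono)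
  then have total: "of_int M * of_int N
      \<le> real (card (coprime_pairs M N)) + real (card (common_multiples 2 M N)) + real (card odds)"
    using assms by simp
  have even_le: "real (card (common_multiples 2 M N)) \<le> of_int M * of_int N / 4"
    using card_common_multiples_le[of 2 M N] assms by simp
  define T :: real where "T = of_int M * of_int N / 4"
  have "0 \<le> T" using assms by (simp add: T_def)
  have odd_le: "real (card (common_multiples (2 * int k + 1) M N))
      \<le> - T / real (Suc k) - (- T / real k)" if "1 \<le> k" for k
  proof -
    have "real (card (common_multiples (2 * int k + 1) M N)) \<le> 4 * T / (2 * real k + 1)\<^sup>2"
      using card_common_multiples_le[of "2 * int k + 1" M N] assms by (simp add: T_def)
    also have "\<dots> \<le> 4 * T / (4 * real k * (real k + 1))"
      proof (rule frac_le)
      show "4 * real k * (real k + 1) \<le> (2 * real k + 1)\<^sup>2"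
        by (simp add: power2_eq_square distrib_left distrib_right)
    qed (use that \<open>0 \<le> T\<close> in simp_all)
    also have "\<dots> = T / (real k * real (Suc k))" by (simp add: mult.assoc add.commute)
    also have "\<dots> = - T / real (Suc k) - (- T / real k)"
      using that by (simp add: divide_simps) (simp add: distrib_left)
    finally show ?thesis .
  qed
  have "card odds \<le> (\<Sum>k\<in>{1..<Suc n}. card (common_multiples (2 * int k + 1) M N))"
    unfolding odds_def by (rule card_UN_le) simp
  then have "real (card odds)
      \<le> real (\<Sum>k\<in>{1..<Suc n}. card (common_multiples (2 * int k + 1) M N))"
    by (rule of_nat_mono)
  also have "\<dots> = (\<Sum>k\<in>{1..<Suc n}. real (card (common_multiples (2 * int k + 1) M N)))"
    by simp
  also have "\<dots> \<le> (\<Sum>k\<in>{1..<Suc n}. - T / real (Suc k) - (- T / real k))"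
    by (intro sum_mono odd_le) simp
  also have "\<dots> = - T / real (Suc n) - (- T / real 1)"
    by (rule sum_Suc_diff') simp
  also have "\<dots> \<le> T" using \<open>0 \<le> T\<close> by simp
  finally show ?thesis using total even_le by (simp add: T_def)
qed

section \<open>Points with prescribed greatest common divisor and their fractions\<close>

lemma gcd_scale:
  assumes "z \<in> scale d ` coprime_pairs M N" "0 \<le> d"
  shows "gcd (fst z) (snd z) = d"
  using assms by (auto simp: scale_def coprime_pairs_def gcd_mult_left coprime_iff_gcd_eq_1)

lemma scale_floor_subset_int_points:
  assumes "0 < d"
  shows "scale d ` coprime_pairs \<lfloor>X / of_int d\<rfloor> \<lfloor>Y / of_int d\<rfloor> \<subseteq> int_points X Y"
  using assms
  by (auto simp: scale_def coprime_pairs_def int_points_def le_floor_iff field_simps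
      int_one_le_iff_zero_less)

text \<open>
  The constant 9/20 is 1/2, for coprimality, times 9/10, for the two roundings: each of these
  loses at most one unit out of at least twenty, and \<open>(19/20)\<^sup>2 \<ge> 9/10\<close>.
\<close>

lemma card_scaled_coprime_pairs_ge:
  assumes d: "0 < d" and X: "20 * of_int d \<le> X" and Y: "20 * of_int d \<le> Y"
  shows "9 / 20 * (X * Y) / (of_int d)\<^sup>2
      \<le> real (card (scale d ` coprime_pairs \<lfloor>X / of_int d\<rfloor> \<lfloor>Y / of_int d\<rfloor>))"
proof -
  have floor: "19 / 20 * t \<le> of_int \<lfloor>t\<rfloor>" if "20 \<le> t" for t :: real
    using that by linarith
  define x y where "x = X / of_int d" and "y = Y / of_int d"
  have xy: "20 \<le> x" "20 \<le> y"
    using assms by (simp_all add: x_def y_def field_simps)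
  have "9 / 10 * (x * y) \<le> (19 / 20 * x) * (19 / 20 * y)"
    using xy by simp
  also have "\<dots> \<le> of_int \<lfloor>x\<rfloor> * of_int \<lfloor>y\<rfloor>"
    using xy by (intro mult_mono floor) auto
  finally have "9 / 20 * (x * y) \<le> of_int \<lfloor>x\<rfloor> * of_int \<lfloor>y\<rfloor> / 2" by simp
  also have "\<dots> \<le> real (card (coprime_pairs \<lfloor>x\<rfloor> \<lfloor>y\<rfloor>))"
    using xy by (intro coprime_pairs_ge_half) auto
  also have "card (coprime_pairs \<lfloor>x\<rfloor> \<lfloor>y\<rfloor>) = card (scale d ` coprime_pairs \<lfloor>x\<rfloor> \<lfloor>y\<rfloor>)"
    using d by (intro card_image[symmetric]) (auto simp: inj_on_def scale_def)
  finally show ?thesis by (simp add: x_def y_def power2_eq_square)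
qed

text \<open>Scaling a point does not change its fraction, so the fractions are counted before scaling.\<close>

lemma card_Frac_scaled_le:
  assumes D: "0 < D" and d: "\<And>d. d \<in> A \<Longrightarrow> D \<le> d" and "0 \<le> X" "0 \<le> Y"
  shows "real (card (Frac (\<Union>d\<in>A. scale d ` coprime_pairs \<lfloor>X / of_int d\<rfloor> \<lfloor>Y / of_int d\<rfloor>)))
      \<le> (X / of_int D) * (Y / of_int D)" (is "real (card (Frac ?C)) \<le> _")
proof -
  define box where "box = {1..\<lfloor>X / of_int D\<rfloor>} \<times> {1..\<lfloor>Y / of_int D\<rfloor>}"
  have "Frac ?C \<subseteq> (\<lambda>(p, q). of_int p / of_int q) ` box"
  proof
    fix r assume "r \<in> Frac ?C"
    then obtain d p q where dA: "d \<in> A" and r: "r = of_int (d * p) / of_int (d * q)"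
      and pq: "(p, q) \<in> coprime_pairs \<lfloor>X / of_int d\<rfloor> \<lfloor>Y / of_int d\<rfloor>"
      by (auto simp: Frac_def scale_def)
    have "D \<le> d" using d dA by blast
    then have "X / of_int d \<le> X / of_int D" "Y / of_int d \<le> Y / of_int D"
      using D assms(3,4) by (auto intro!: divide_left_mono)
    then have "\<lfloor>X / of_int d\<rfloor> \<le> \<lfloor>X / of_int D\<rfloor>" "\<lfloor>Y / of_int d\<rfloor> \<le> \<lfloor>Y / of_int D\<rfloor>"
      by (auto intro: floor_mono)
    then have "(p, q) \<in> box" using pq by (auto simp: coprime_pairs_def box_def)
    moreover have "r = of_int p / of_int q" using r D \<open>D \<le> d\<close> by simp
    ultimately show "r \<in> (\<lambda>(p, q). of_int p / of_int q) ` box" by force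
  qed
  then have "card (Frac ?C) \<le> card box"
    by (intro surj_card_le) (simp_all add: box_def)
  then have "real (card (Frac ?C)) \<le> real (card box)" by linarith
  also have "\<dots> = of_int \<lfloor>X / of_int D\<rfloor> * of_int \<lfloor>Y / of_int D\<rfloor>"
    using assms by (simp add: box_def card_cartesian_product)
  also have "\<dots> \<le> (X / of_int D) * (Y / of_int D)"
    using assms by (intro mult_mono) auto
  finally show ?thesis .
qed

section \<open>Summation over the greatest common divisor\<close>

lemma sum_inverse_squares_ge:
  assumes "0 < m" "m \<le> n"
  shows "1 / real m - 1 / real n \<le> (\<Sum>d\<in>{m..<n}. 1 / (real d)\<^sup>2)"
proof -
  have "1 / real m - 1 / real n = (\<Sum>d\<in>{m..<n}. - 1 / real (Suc d) - (- 1 / real d))"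
    using assms by (subst sum_Suc_diff') auto
  also have "\<dots> \<le> (\<Sum>d\<in>{m..<n}. 1 / (real d)\<^sup>2)"
  proof (rule sum_mono)
    fix d assume "d \<in> {m..<n}"
    then have "0 < real d" using assms by simp
    then have "- 1 / real (Suc d) - (- 1 / real d) = 1 / (real d * (real d + 1))"
      by (simp add: field_simps)
    also have "\<dots> \<le> 1 / (real d)\<^sup>2"
      using \<open>0 < real d\<close> by (intro divide_left_mono) (auto simp: power2_eq_square)
    finally show "- 1 / real (Suc d) - (- 1 / real d) \<le> 1 / (real d)\<^sup>2" .
  qed
  finally show ?thesis .
qed

theorem theorem1p3:
  fixes \<gamma> :: real
  assumes "0 < \<gamma>" and "\<gamma> \<le> 1"
  shows "\<exists>N0::real. \<forall>X\<ge>N0. \<forall>Y\<ge>N0. \<exists>C \<subseteq> int_points X Y.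
           real (card C) \<ge> \<gamma> / 8 * X * Y \<and>
           real (card (Frac C)) \<le> \<gamma>\<^sup>2 / 2 * X * Y"
proof -
  define D where "D = nat \<lceil>2 / \<gamma>\<rceil>"
  have "2 / \<gamma> \<le> real D" "real D \<le> 2 / \<gamma> + 1"
    using assms by (simp_all add: D_def)
  then have D_lower: "2 \<le> \<gamma> * real D" and D_upper: "\<gamma> * real D \<le> 3"
    using assms by (auto simp: field_simps)
  have D_pos: "0 < D" using D_lower by (cases D) auto
  \<comment> \<open>The bound is 20 times 12 D, so that every \<open>X / d\<close> and \<open>Y / d\<close> with \<open>d < 12 D\<close> is at least 20.\<close>
  show ?thesis
  proof (intro exI[of _ "240 * real D"] allI impI)
    fix X Y :: real
    assume X: "240 * real D \<le> X" and Y: "240 * real D \<le> Y"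
    have XY: "0 \<le> X" "0 \<le> Y" "0 \<le> X * Y"
      using X Y by (auto intro: order_trans[rotated])
    define L where "L d = scale d ` coprime_pairs \<lfloor>X / of_int d\<rfloor> \<lfloor>Y / of_int d\<rfloor>" for d
    define A where "A = {D..<12 * D}"
    define C where "C = (\<Union>d\<in>int ` A. L d)"
    have sub: "C \<subseteq> int_points X Y"
      unfolding C_def L_def A_def
      using D_pos by (intro UN_least scale_floor_subset_int_points) auto

    have "card C = (\<Sum>d\<in>int ` A. card (L d))"
      unfolding C_def
    proof (rule card_UN_disjoint)
      show "\<forall>d\<in>int ` A. finite (L d)" by (simp add: L_def finite_coprime_pairs)
      have "gcd (fst z) (snd z) = d" if "z \<in> L d" "d \<in> int ` A" for z d
        using that gcd_scale unfolding L_def by fastforce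
      then show "\<forall>d\<in>int ` A. \<forall>e\<in>int ` A. d \<noteq> e \<longrightarrow> L d \<inter> L e = {}"
        unfolding disjoint_iff by metis
    qed (simp add: A_def)
    also have "\<dots> = (\<Sum>d\<in>A. card (L (int d)))"
      by (simp add: sum.reindex)
    finally have card_C: "real (card C) = (\<Sum>d\<in>A. real (card (L (int d))))" by simp
    have "1 / real D - 1 / real (12 * D) \<le> (\<Sum>d\<in>A. 1 / (real d)\<^sup>2)"
      unfolding A_def using D_pos by (intro sum_inverse_squares_ge) auto
    moreover have "1 / real D - 1 / real (12 * D) = 11 / 12 * (1 / real D)"
      using D_pos by (simp add: field_simps)
    moreover have "\<gamma> / 3 \<le> 1 / real D"
      using D_upper D_pos by (simp add: field_simps)
    ultimately have "11 / 36 * \<gamma> \<le> (\<Sum>d\<in>A. 1 / (real d)\<^sup>2)" by linarith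
    then have "9 / 20 * (X * Y) * (11 / 36 * \<gamma>) \<le> 9 / 20 * (X * Y) * (\<Sum>d\<in>A. 1 / (real d)\<^sup>2)"
      using XY by (intro mult_left_mono) auto
    also have "\<dots> = (\<Sum>d\<in>A. 9 / 20 * (X * Y) / (of_int (int d))\<^sup>2)"
      by (simp add: sum_distrib_left)
    also have "\<dots> \<le> (\<Sum>d\<in>A. real (card (L (int d))))"
      unfolding L_def using X Y D_pos
      by (intro sum_mono card_scaled_coprime_pairs_ge) (auto simp: A_def)
    finally have "9 / 20 * (X * Y) * (11 / 36 * \<gamma>) \<le> real (card C)" by (simp add: card_C)
    moreover have "\<gamma> / 8 * X * Y \<le> 9 / 20 * (X * Y) * (11 / 36 * \<gamma>)"
      using mult_nonneg_nonneg[OF XY(3), of \<gamma>] assms by (simp add: field_simps)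
    ultimately have many: "\<gamma> / 8 * X * Y \<le> real (card C)" by linarith

    have "1 / real D \<le> \<gamma> / 2" using D_lower D_pos by (simp add: field_simps)
    then have quotient: "Z / real D \<le> \<gamma> / 2 * Z" if "0 \<le> Z" for Z :: real
      using mult_right_mono[of "1 / real D" "\<gamma> / 2" Z] that by simp
    have "real (card (Frac C)) \<le> (X / of_int (int D)) * (Y / of_int (int D))"
      unfolding C_def L_def using D_pos XY
      by (intro card_Frac_scaled_le) (auto simp: A_def)
    also have "\<dots> \<le> (\<gamma> / 2 * X) * (\<gamma> / 2 * Y)"
      using quotient XY assms by (intro mult_mono) auto
    also have "\<dots> \<le> \<gamma>\<^sup>2 / 2 * X * Y"
      using mult_nonneg_nonneg[OF XY(3), of "\<gamma>\<^sup>2"] by (simp add: power2_eq_square field_simps)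
    finally have few: "real (card (Frac C)) \<le> \<gamma>\<^sup>2 / 2 * X * Y" .

    show "\<exists>C \<subseteq> int_points X Y. real (card C) \<ge> \<gamma> / 8 * X * Y \<and>
           real (card (Frac C)) \<le> \<gamma>\<^sup>2 / 2 * X * Y"
      using sub many few by blast
  qed
qed

end
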